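(* Let $n\ge1$ and $m\ge 2$, let $\boldsymbol{r}_1,\ldots,\boldsymbol{r}_m\in\mathbb{R}^n$ and $w_1,\ldots,w_m\in\mathbb{R}$. In the idempotent semifield $\mathbb{R}_{\max,+}$ define the column vector $\boldsymbol{p}=(p_1,\ldots,p_n)^T\in\mathbb{R}^n$ and the column vector $\boldsymbol{q}=(q_1,\ldots,q_n)^T\in\mathbb{R}^n$ by $$ \boldsymbol{p}=w_1\boldsymbol{r}_1\oplus\cdots\oplus w_m\boldsymbol{r}_m,\qquad \boldsymbol{q}^{-}=w_1\boldsymbol{r}_1^{-}\oplus\cdots\oplus w_m\boldsymbol{r}_m^{-}. $$ Then the minimum in the problem $$ \min_{\boldsymbol{x}\in\mathbb{R}^n}\left(\boldsymbol{x}^{-}\boldsymbol{p}\oplus\boldsymbol{q}^{-}\boldsymbol{x}\right) $$ is given by $\lambda=(\boldsymbol{q}^{-}\boldsymbol{p})^{1/2}$, and it is attained at any vector $$ \boldsymbol{x}=\lambda^{1-2\alpha}\left(\begin{array}{c}p_1^{\alpha}q_1^{1-\alpha}\\ \vdots\\ p_n^{\alpha}q_n^{1-\alpha}\end{array}\right),\qquad 0\le\alpha\le1, $$ where all operations and powers are those of $\mathbb{R}_{\max,+}$.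
   Context: $\mathbb{R}_{\max,+}=(\mathbb{R}\cup\{-\infty\},-\infty,0,\max,+)$ is the idempotent semifield in which addition $\oplus$ is $\max$, multiplication (sign omitted) is ordinary $+$, the zero is $\mathbb{0}=-\infty$ and the identity is $\mathbb{1}=0$. For $x\in\mathbb{R}$ the inverse $x^{-1}$ is the ordinary $-x$, and for $x,y\in\mathbb{R}$ the power $x^{y}$ is the ordinary product $xy$. The order is the usual order on $\mathbb{R}$. Vector addition, multiplication of vectors by scalars and products of row and column vectors follow the usual formulas with these operations. For a column vector $\boldsymbol{x}=(x_i)\in\mathbb{R}^n$, $\boldsymbol{x}^{-}$ is the row vector with entries $x_i^{-1}=-x_i$. Thus, in ordinary notation, $\boldsymbol{x}^{-}\boldsymbol{p}=\max_i(p_i-x_i)$ and $\boldsymbol{q}^{-}\boldsymbol{x}=\max_i(x_i-q_i)$. *)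

theory Defs
  imports "HOL-Analysis.Finite_Cartesian_Product"
begin

text \<open>
  The idempotent semifield \<open>\<real>\<^sub>m\<^sub>a\<^sub>x\<^sub>,\<^sub>+\<close>: the type class operations \<open>+\<close>, \<open>*\<close>, \<open>0\<close>, \<open>1\<close> on
  \<open>maxplus\<close> are maximum, ordinary addition, \<open>-\<infinity>\<close> and the real number \<open>0\<close>. Finite sums are
  therefore finite maxima. The element \<open>Fin a\<close> is the real number \<open>a\<close>.
\<close>

datatype maxplus = MinusInf | Fin real

instantiation maxplus :: linorder
begin

fun less_eq_maxplus :: "maxplus \<Rightarrow> maxplus \<Rightarrow> bool" where
  "MinusInf \<le> y \<longleftrightarrow> True"
| "Fin a \<le> MinusInf \<longleftrightarrow> False"
| "Fin a \<le> Fin b \<longleftrightarrow> a \<le> b"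

definition less_maxplus :: "maxplus \<Rightarrow> maxplus \<Rightarrow> bool" where
  "x < y \<longleftrightarrow> x \<le> y \<and> \<not> y \<le> (x :: maxplus)"

instance
proof
  fix x y z :: maxplus
  show "x < y \<longleftrightarrow> x \<le> y \<and> \<not> y \<le> x" by (rule less_maxplus_def)
  show "x \<le> x" by (cases x) auto
  show "x \<le> y \<Longrightarrow> y \<le> z \<Longrightarrow> x \<le> z" by (cases x; cases y; cases z) auto
  show "x \<le> y \<Longrightarrow> y \<le> x \<Longrightarrow> x = y" by (cases x; cases y) auto
  show "x \<le> y \<or> y \<le> x" by (cases x; cases y) auto
qed

end

instantiation maxplus :: comm_semiring_1
begin

definition zero_maxplus :: maxplus where
  "0 = MinusInf"

definition one_maxplus :: maxplus where
  "1 = Fin 0"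

definition plus_maxplus :: "maxplus \<Rightarrow> maxplus \<Rightarrow> maxplus" where
  "x + y = max x (y :: maxplus)"

fun times_maxplus :: "maxplus \<Rightarrow> maxplus \<Rightarrow> maxplus" where
  "Fin a * Fin b = Fin (a + b)"
| "MinusInf * y = MinusInf"
| "Fin a * MinusInf = MinusInf"

instance
proof
  fix x y z :: maxplus
  show "x + y + z = x + (y + z)" by (simp add: plus_maxplus_def max.assoc)
  show "x + y = y + x" by (simp add: plus_maxplus_def max.commute)
  show "0 + x = x" by (simp add: plus_maxplus_def zero_maxplus_def max_def)
  show "x * y * z = x * (y * z)" by (cases x; cases y; cases z) auto
  show "x * y = y * x" by (cases x; cases y) auto
  show "1 * x = x" by (cases x) (auto simp: one_maxplus_def)
  show "(x + y) * z = x * z + y * z"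
    by (cases x; cases y; cases z) (auto simp: plus_maxplus_def max_def)
  show "0 * x = 0" by (simp add: zero_maxplus_def)
  show "x * 0 = 0" by (cases x) (auto simp: zero_maxplus_def)
  show "(0 :: maxplus) \<noteq> 1" by (simp add: zero_maxplus_def one_maxplus_def)
qed

end

text \<open>
  The values of the following two functions at \<open>-\<infinity>\<close> are junk: inverses and real powers are only
  meant for real arguments. Exponents are ordinary real numbers.
\<close>

fun mp_inverse :: "maxplus \<Rightarrow> maxplus" where
  "mp_inverse (Fin a) = Fin (- a)"
| "mp_inverse MinusInf = MinusInf"

fun mp_power :: "maxplus \<Rightarrow> real \<Rightarrow> maxplus"  (infixr "\<up>" 80) where
  "Fin a \<up> y = Fin (a * y)"
| "MinusInf \<up> y = MinusInf"

lemma maxplus_add_idem: "x + x = (x :: maxplus)"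
  by (simp add: plus_maxplus_def)

lemma maxplus_inverse: "x \<noteq> 0 \<Longrightarrow> mp_inverse x * x = 1"
  by (cases x) (auto simp: zero_maxplus_def one_maxplus_def)

definition mp_reals :: "maxplus set" where
  "mp_reals = range Fin"

definition mp_real_vectors :: "(maxplus ^ 'n) set" where
  "mp_real_vectors = {x. \<forall>i. x $ i \<in> mp_reals}"

text \<open>
  Row and column vectors share the type \<open>maxplus ^ 'n\<close>; conjugate transposition turns a column into
  a row, and \<open>y \<odot> x\<close> is the product of the row \<open>y\<close> with the column \<open>x\<close>.
\<close>

definition conj_transpose :: "maxplus ^ 'n \<Rightarrow> maxplus ^ 'n"  ("_\<^sup>-" [1000] 999) where
  "x\<^sup>- = (\<chi> i. mp_inverse (x $ i))"

definition row_times_col :: "maxplus ^ 'n \<Rightarrow> maxplus ^ 'n \<Rightarrow> maxplus"  (infixl "\<odot>" 70) where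
  "y \<odot> x = (\<Sum>i\<in>UNIV. y $ i * x $ i)"

end

theory Submission
  imports Defs
begin

text \<open>
  For every index \<open>i\<close> the larger of \<open>p\<^sub>i - x\<^sub>i\<close> and \<open>x\<^sub>i - q\<^sub>i\<close> is at least their mean
  \<open>(p\<^sub>i - q\<^sub>i) / 2\<close>, so the objective is at least \<open>\<lambda> = D / 2\<close>, where \<open>D\<close> is the maximum of
  \<open>p\<^sub>i - q\<^sub>i\<close>. At the proposed \<open>x\<close> both \<open>p\<^sub>i - x\<^sub>i\<close> and \<open>x\<^sub>i - q\<^sub>i\<close> are \<open>\<lambda>\<close> minus a
  nonnegative multiple of \<open>D - (p\<^sub>i - q\<^sub>i)\<close>, the factors being \<open>1 - \<alpha>\<close> and \<open>\<alpha>\<close>.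
\<close>

lemma maxplus_sum_eq_Max:
  fixes f :: "'a \<Rightarrow> maxplus"
  assumes "finite A" "A \<noteq> {}"
  shows "sum f A = Max (f ` A)"
  using assms by (induction A rule: finite_ne_induct) (simp_all, simp add: plus_maxplus_def)

lemma mono_Fin: "mono Fin"
  by (auto intro: monoI)

lemma Fin_plus: "Fin a + Fin b = Fin (max a b)"
  by (auto simp: plus_maxplus_def max_def)

text \<open>A maximum over a nonempty finite set is one of its terms, so it stays real; the empty
  sum would be \<open>MinusInf\<close>.\<close>

lemma sum_mem_mp_reals:
  assumes "finite A" "A \<noteq> {}" "\<And>a. a \<in> A \<Longrightarrow> f a \<in> mp_reals"
  shows "sum f A \<in> mp_reals"
proof -
  have "Max (f ` A) \<in> f ` A"
    using assms(1,2) by (intro Max_in) auto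
  then show ?thesis
    using assms(3) by (auto simp: maxplus_sum_eq_Max[OF assms(1,2)])
qed

lemma times_mem_mp_reals: "x \<in> mp_reals \<Longrightarrow> y \<in> mp_reals \<Longrightarrow> x * y \<in> mp_reals"
  by (auto simp: mp_reals_def)

text \<open>The converse direction relies on the junk value: \<open>mp_inverse\<close> sends
  \<open>MinusInf\<close> to itself, not to a real.\<close>

lemma mp_inverse_mem_mp_reals_iff: "mp_inverse x \<in> mp_reals \<longleftrightarrow> x \<in> mp_reals"
  by (cases x) (auto simp: mp_reals_def)

lemma conj_transpose_mem_mp_real_vectors_iff:
  "x\<^sup>- \<in> mp_real_vectors \<longleftrightarrow> x \<in> mp_real_vectors"
  by (simp add: mp_real_vectors_def conj_transpose_def mp_inverse_mem_mp_reals_iff)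

lemma sum_scaled_mem_mp_real_vectors:
  assumes "finite A" "A \<noteq> {}"
    and "\<And>k. k \<in> A \<Longrightarrow> w k \<in> mp_reals" "\<And>k. k \<in> A \<Longrightarrow> r k \<in> mp_real_vectors"
  shows "(\<Sum>k\<in>A. w k *s r k) \<in> mp_real_vectors"
  using assms
  by (auto simp: mp_real_vectors_def sum_component intro!: sum_mem_mp_reals times_mem_mp_reals)

lemma mem_mp_real_vectorsE:
  assumes "x \<in> mp_real_vectors"
  obtains a where "x = (\<chi> i. Fin (a i))"
proof -
  have "\<forall>i. \<exists>a. x $ i = Fin a"
    using assms by (auto simp: mp_real_vectors_def mp_reals_def image_iff)
  then obtain a where "\<And>i. x $ i = Fin (a i)" by metis
  then show thesis by (intro that[of a]) (simp add: vec_eq_iff)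
qed

lemma Fin_vector_mem_mp_real_vectors: "(\<chi> i. Fin (a i)) \<in> mp_real_vectors"
  by (simp add: mp_real_vectors_def mp_reals_def)

text \<open>Since \<open>Fin\<close> is monotone, it commutes with \<open>Max\<close>. This turns
  both terms of the objective, as well as the product under the root in \<lambda>, into ordinary
  real maxima.\<close>

lemma conj_transpose_times_col_Fin:
  "(\<chi> i. Fin (a i))\<^sup>- \<odot> (\<chi> i. Fin (b i)) = Fin (Max (range (\<lambda>i. b i - a i)))"
  by (simp add: row_times_col_def conj_transpose_def maxplus_sum_eq_Max
      mono_Max_commute[OF mono_Fin] image_image)

lemma mp_problem_lower_bound:
  assumes "p \<in> mp_real_vectors" "q \<in> mp_real_vectors" "x \<in> mp_real_vectors"
  shows "(q\<^sup>- \<odot> p) \<up> (1/2) \<le> x\<^sup>- \<odot> p + q\<^sup>- \<odot> x"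
proof -
  obtain P Q X where vecs: "p = (\<chi> i. Fin (P i))" "q = (\<chi> i. Fin (Q i))" "x = (\<chi> i. Fin (X i))"
    using assms by (metis mem_mp_real_vectorsE)
  have "Max (range (\<lambda>i. P i - Q i)) \<in> range (\<lambda>i. P i - Q i)"
    by (intro Max_in) auto
  then obtain i where i: "Max (range (\<lambda>i. P i - Q i)) = P i - Q i" by (rule imageE)
  have "P i - X i \<le> Max (range (\<lambda>i. P i - X i))" "X i - Q i \<le> Max (range (\<lambda>i. X i - Q i))"
    by (auto intro: Max_ge)
  \<comment> \<open>The two left-hand sides add up to \<open>P i - Q i\<close>, and each is at most
    the larger of the two maxima.\<close>
  then have "P i - Q i \<le> 2 * max (Max (range (\<lambda>i. P i - X i))) (Max (range (\<lambda>i. X i - Q i)))"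
    by linarith
  then show ?thesis
    by (simp add: vecs conj_transpose_times_col_Fin Fin_plus i)
qed

lemma mp_problem_solution:
  fixes \<alpha> :: real
  assumes "p \<in> mp_real_vectors" "q \<in> mp_real_vectors" "0 \<le> \<alpha>" "\<alpha> \<le> 1"
    and lam: "lam = (q\<^sup>- \<odot> p) \<up> (1/2)"
    and x: "x = lam \<up> (1 - 2 * \<alpha>) *s (\<chi> i. (p $ i) \<up> \<alpha> * (q $ i) \<up> (1 - \<alpha>))"
  shows "x \<in> mp_real_vectors \<and> x\<^sup>- \<odot> p + q\<^sup>- \<odot> x = lam"
proof -
  obtain P Q where vecs: "p = (\<chi> i. Fin (P i))" "q = (\<chi> i. Fin (Q i))"
    using assms(1,2) by (metis mem_mp_real_vectorsE)
  define D where "D = Max (range (\<lambda>i. P i - Q i))"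
  \<comment> \<open>The entries of \<open>x\<close> in ordinary arithmetic: powers become products,
    products become sums.\<close>
  define X where "X i = D / 2 * (1 - 2 * \<alpha>) + (P i * \<alpha> + Q i * (1 - \<alpha>))" for i
  have lam_Fin: "lam = Fin (D / 2)"
    by (simp add: lam vecs conj_transpose_times_col_Fin D_def)
  have x_Fin: "x = (\<chi> i. Fin (X i))"
    by (simp add: x lam_Fin vecs X_def vec_eq_iff)
  have D_ge: "P i - Q i \<le> D" for i
    by (auto simp: D_def intro: Max_ge)
  have "D \<in> range (\<lambda>i. P i - Q i)"
    unfolding D_def by (intro Max_in) auto
  then obtain j where j: "D = P j - Q j" by auto
  \<comment> \<open>In this form \<open>D_ge\<close> and the bounds on \<alpha> give the upper bound
    \<open>D / 2\<close>, and at \<open>j\<close> the factor \<open>D - (P j - Q j)\<close>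
    vanishes, so the bound is attained in both maxima at the same index.\<close>
  have PX: "P i - X i = D / 2 - (1 - \<alpha>) * (D - (P i - Q i))" for i
    by (simp add: X_def field_simps)
  have XQ: "X i - Q i = D / 2 - \<alpha> * (D - (P i - Q i))" for i
    by (simp add: X_def field_simps)
  have "Max (range (\<lambda>i. P i - X i)) = D / 2"
  proof (rule Max_eqI)
    show "D / 2 \<in> range (\<lambda>i. P i - X i)"
      by (rule range_eqI[of _ _ j]) (simp add: PX j)
  qed (use D_ge \<open>\<alpha> \<le> 1\<close> in \<open>auto simp: PX\<close>)
  moreover have "Max (range (\<lambda>i. X i - Q i)) = D / 2"
  proof (rule Max_eqI)
    show "D / 2 \<in> range (\<lambda>i. X i - Q i)"
      by (rule range_eqI[of _ _ j]) (simp add: XQ j)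
  qed (use D_ge \<open>0 \<le> \<alpha>\<close> in \<open>auto simp: XQ\<close>)
  ultimately show ?thesis
    by (simp add: x_Fin vecs lam_Fin conj_transpose_times_col_Fin Fin_plus
        Fin_vector_mem_mp_real_vectors)
qed

theorem lemma2:
  fixes m :: nat
    and r :: "nat \<Rightarrow> maxplus ^ 'n"
    and w :: "nat \<Rightarrow> maxplus"
    and p q :: "maxplus ^ 'n"
    and lam :: maxplus
  assumes "m \<ge> 2"
    and "\<And>k. k \<in> {1..m} \<Longrightarrow> r k \<in> mp_real_vectors"
    and "\<And>k. k \<in> {1..m} \<Longrightarrow> w k \<in> mp_reals"
    and "p = (\<Sum>k=1..m. w k *s r k)"
    and "q\<^sup>- = (\<Sum>k=1..m. w k *s (r k)\<^sup>-)"
    and "lam = (q\<^sup>- \<odot> p) \<up> (1/2)"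
  shows "lam \<in> (\<lambda>x. x\<^sup>- \<odot> p + q\<^sup>- \<odot> x) ` mp_real_vectors \<and>
         (\<forall>x \<in> mp_real_vectors. lam \<le> x\<^sup>- \<odot> p + q\<^sup>- \<odot> x) \<and>
         (\<forall>\<alpha>::real. 0 \<le> \<alpha> \<and> \<alpha> \<le> 1 \<longrightarrow>
           (let x = lam \<up> (1 - 2 * \<alpha>) *s (\<chi> i. (p $ i) \<up> \<alpha> * (q $ i) \<up> (1 - \<alpha>))
            in x \<in> mp_real_vectors \<and> x\<^sup>- \<odot> p + q\<^sup>- \<odot> x = lam))"
proof -
  have p: "p \<in> mp_real_vectors"
    unfolding assms(4) using assms(1-3) by (intro sum_scaled_mem_mp_real_vectors) auto
  \<comment> \<open>The hypotheses determine \<open>q\<close> only through its conjugate, so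
    realness is shown there first and then carried back.\<close>
  have "q\<^sup>- \<in> mp_real_vectors"
    unfolding assms(5) using assms(1-3)
    by (intro sum_scaled_mem_mp_real_vectors)
      (auto simp: conj_transpose_mem_mp_real_vectors_iff)
  then have q: "q \<in> mp_real_vectors"
    by (simp add: conj_transpose_mem_mp_real_vectors_iff)
  note sol = mp_problem_solution[OF p q _ _ assms(6) refl]
  have "lam \<in> (\<lambda>x. x\<^sup>- \<odot> p + q\<^sup>- \<odot> x) ` mp_real_vectors"
    \<comment> \<open>Any \<alpha> in the unit interval yields a minimizer; 0 is chosen as a witness
      that \<lambda> is attained.\<close>
    using sol[of 0] by (auto intro!: rev_image_eqI)
  then show ?thesis
    using sol mp_problem_lower_bound[OF p q] by (simp add: Let_def assms(6))
qed

end
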